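(* Let $\mathrm{Br}$ be the best response function described in the context, Lipschitz in $z$ with constant $L_z<1$ and Lipschitz in $\alpha$ with constant $L$, and let $\alpha_1,\dots,\alpha_n\in\mathbb{R}$ be the agents' parameters. Let $\{C_j\}_{j=1}^k$ be the cells of a quantization scheme on $\mathbb{R}$ with representatives $c_j\in C_j$. Let $\hat z^\star_{n,\rm AEM}$ be the solution of the $P_n(\alpha)$-based approximation method and $\tilde z^\star_{n,\rm AEM}$ the solution of the $\alpha_i$-quantized approximation method. Then $$\left|\tilde z^\star_{n,\rm AEM}-\hat z^\star_{n,\rm AEM}\right|\le\frac{L}{1-L_z}\,\mathsf{E}_{\hat\nu_n}\left[\left|\tilde\nu_n-\hat\nu_n\right|\right],$$ where $\hat\nu_n$ is uniformly distributed over $\{\alpha_i\}_{i=1}^n$ (i.e. has distribution function $P_n$), $\tilde\nu_n=c_j$ if $\hat\nu_n\in C_j$, and the expectation is with respect to the distribution of $\hat\nu_n$ ($\tilde\nu_n$ being a function of $\hat\nu_n$).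
   Context: Let $n\ge2$, let $a\le b$ be reals, and let $u:[a,b]\times\mathbb{R}\times\mathbb{R}\to\mathbb{R}$ be a utility function $u(x,z,\alpha)$ (action $x$, mean of the other agents' actions $z$, parameter $\alpha$). No convergence of empirical distributions is assumed. Best response. $\mathrm{Br}(z,\alpha)=\arg\max_{a\le x\le b}u(x,z,\alpha)$; for all $z,\alpha\in\mathbb{R}$ the maximizer is assumed to exist and be unique, so $\mathrm{Br}:\mathbb{R}\times\mathbb{R}\to[a,b]$ is a function. Assumptions. (1) There is a constant $0<L_z<1$ with $|\mathrm{Br}(z,\alpha)-\mathrm{Br}(z',\alpha)|\le L_z|z-z'|$ for all $z,z',\alpha\in\mathbb{R}$. (2) There is a constant $L>0$ with $|\mathrm{Br}(z,\alpha)-\mathrm{Br}(z,\alpha')|\le L|\alpha-\alpha'|$ for all $z,\alpha,\alpha'\in\mathbb{R}$. $P_n(\alpha)$-based approximation. $P_n(\alpha)=\frac1n\sum_{i=1}^n\mathbf{1}\{\alpha_i\le\alpha\}$, and $\hat z^\star_{n,\rm AEM}$ is the (unique) solution $z$ of $z=\frac1n\sum_{i=1}^n\mathrm{Br}(z,\alpha_i)$. Quantization. $\{C_j\}_{j=1}^k$ is a partition of $\mathbb{R}$ into $k$ non-overlapping cells, each right-closed (i.e. $\sup C_j\in C_j$ whenever $\sup C_j$ is finite), and $c_j\in C_j$ is the representative of $C_j$. $\alpha_i$-quantized approximation. $\tilde z^\star_{n,\rm AEM}$ is the (unique) solution $z$ of $$z=\sum_{j=1}^k\mathrm{Br}(z,c_j)\,\frac1n\sum_{i=1}^n\mathbf{1}\{\alpha_i\in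 C_j\}=\mathsf{E}_{\tilde\nu_n}[\mathrm{Br}(z,\tilde\nu_n)].$$ *)

theory Defs
  imports "HOL-Probability.Probability"
begin

text \<open>
  The action argument of the utility comes first and only its values on \<open>{a..b}\<close> matter.
  \<^const>\<open>arg_max\<close> picks some maximizer, so this is the best response only when the maximizer
  exists and is unique.
\<close>

definition best_response ::
    "(real \<Rightarrow> real \<Rightarrow> real \<Rightarrow> real) \<Rightarrow> real \<Rightarrow> real \<Rightarrow> real \<Rightarrow> real \<Rightarrow> real" where
  "best_response u a b z \<alpha> = arg_max (\<lambda>x. u x z \<alpha>) (\<lambda>x. x \<in> {a..b})"

definition unique_best_response ::
    "(real \<Rightarrow> real \<Rightarrow> real \<Rightarrow> real) \<Rightarrow> real \<Rightarrow> real \<Rightarrow> bool" where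
  "unique_best_response u a b \<longleftrightarrow>
     (\<forall>z \<alpha>. \<exists>!x. is_arg_max (\<lambda>x. u x z \<alpha>) (\<lambda>x. x \<in> {a..b}) x)"

definition empirical_cdf :: "nat \<Rightarrow> (nat \<Rightarrow> real) \<Rightarrow> real \<Rightarrow> real" where
  "empirical_cdf n \<alpha> x = (1 / real n) * (\<Sum>i=1..n. of_bool (\<alpha> i \<le> x))"

text \<open>
  The parameters need not be distinct, so the uniform distribution over them is the image of the
  uniform distribution on the indices (repeated values are counted with multiplicity).
\<close>

definition empirical_pmf :: "nat \<Rightarrow> (nat \<Rightarrow> real) \<Rightarrow> real pmf" where
  "empirical_pmf n \<alpha> = map_pmf \<alpha> (pmf_of_set {1..n})"

lemma cdf_empirical_pmf:
  assumes "n \<ge> 1"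
  shows "cdf (measure_pmf (empirical_pmf n \<alpha>)) x = empirical_cdf n \<alpha> x"
proof -
  have "cdf (measure_pmf (empirical_pmf n \<alpha>)) x = real (card ({1..n} \<inter> \<alpha> -` {..x})) / real n"
    using assms by (simp add: cdf_def empirical_pmf_def measure_pmf_of_set)
  also have "{1..n} \<inter> \<alpha> -` {..x} = {1..n} \<inter> {i. \<alpha> i \<le> x}"
    by auto
  also have "real (card \<dots>) = (\<Sum>i=1..n. of_bool (\<alpha> i \<le> x))"
    by simp
  finally show ?thesis
    by (simp add: empirical_cdf_def)
qed

lemma expectation_empirical_pmf:
  fixes f :: "real \<Rightarrow> real"
  assumes "n \<ge> 1"
  shows "measure_pmf.expectation (empirical_pmf n \<alpha>) f = (1 / real n) * (\<Sum>i=1..n. f (\<alpha> i))"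
  using assms by (simp add: empirical_pmf_def integral_pmf_of_set)

text \<open>
  The cells are nonempty because each contains its representative. For a nonempty set of reals,
  having a finite supremum means being bounded above.
\<close>

definition quantization :: "nat \<Rightarrow> (nat \<Rightarrow> real set) \<Rightarrow> (nat \<Rightarrow> real) \<Rightarrow> bool" where
  "quantization k C c \<longleftrightarrow>
     disjoint_family_on C {1..k} \<and>
     (\<Union>j\<in>{1..k}. C j) = UNIV \<and>
     (\<forall>j\<in>{1..k}. c j \<in> C j) \<and>
     (\<forall>j\<in>{1..k}. bdd_above (C j) \<longrightarrow> Sup (C j) \<in> C j)"

definition quantizer ::
    "nat \<Rightarrow> (nat \<Rightarrow> real set) \<Rightarrow> (nat \<Rightarrow> real) \<Rightarrow> real \<Rightarrow> real" where
  "quantizer k C c x = c (THE j. j \<in> {1..k} \<and> x \<in> C j)"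

lemma quantizer_eq:
  assumes "quantization k C c" "j \<in> {1..k}" "x \<in> C j"
  shows "quantizer k C c x = c j"
proof -
  have "(THE i. i \<in> {1..k} \<and> x \<in> C i) = j"
  proof (rule the_equality)
    fix i
    assume i: "i \<in> {1..k} \<and> x \<in> C i"
    have "disjoint_family_on C {1..k}"
      using assms(1) by (simp add: quantization_def)
    then show "i = j"
      using disjoint_family_onD[of C "{1..k}" i j] i assms(2,3) by auto
  qed (use assms in simp)
  then show ?thesis
    by (simp add: quantizer_def)
qed

definition P_approx_solution ::
    "(real \<Rightarrow> real \<Rightarrow> real) \<Rightarrow> nat \<Rightarrow> (nat \<Rightarrow> real) \<Rightarrow> real" where
  "P_approx_solution Br n \<alpha> = (THE z. z = (1 / real n) * (\<Sum>i=1..n. Br z (\<alpha> i)))"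

definition quantized_solution ::
    "(real \<Rightarrow> real \<Rightarrow> real) \<Rightarrow> nat \<Rightarrow> (nat \<Rightarrow> real) \<Rightarrow>
       nat \<Rightarrow> (nat \<Rightarrow> real set) \<Rightarrow> (nat \<Rightarrow> real) \<Rightarrow> real" where
  "quantized_solution Br n \<alpha> k C c =
     (THE z. z = (\<Sum>j=1..k. Br z (c j) * ((1 / real n) * (\<Sum>i=1..n. of_bool (\<alpha> i \<in> C j)))))"

lemma expectation_quantized:
  fixes f :: "real \<Rightarrow> real"
  assumes "n \<ge> 1" and q: "quantization k C c"
  shows "measure_pmf.expectation (map_pmf (quantizer k C c) (empirical_pmf n \<alpha>)) f =
    (\<Sum>j=1..k. f (c j) * ((1 / real n) * (\<Sum>i=1..n. of_bool (\<alpha> i \<in> C j))))"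
proof -
  have *: "(\<Sum>j=1..k. f (c j) * of_bool (x \<in> C j)) = f (quantizer k C c x)" for x
  proof -
    obtain m where m: "m \<in> {1..k}" "x \<in> C m"
      using q UNIV_I[of x] unfolding quantization_def by (metis UN_E)
    have d: "disjoint_family_on C {1..k}"
      using q by (simp add: quantization_def)
    have "x \<in> C j \<longleftrightarrow> j = m" if "j \<in> {1..k}" for j
      using disjoint_family_onD[OF d that m(1)] m(2) by auto
    then have "(\<Sum>j=1..k. f (c j) * of_bool (x \<in> C j)) = (\<Sum>j=1..k. if j = m then f (c j) else 0)"
      by (intro sum.cong) auto
    also have "\<dots> = f (c m)"
      using m(1) by simp
    finally show ?thesis
      using quantizer_eq[OF q m] by simp
  qed
  have "(\<Sum>j=1..k. f (c j) * ((1 / real n) * (\<Sum>i=1..n. of_bool (\<alpha> i \<in> C j)))) =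
      (\<Sum>j=1..k. (1 / real n) * (\<Sum>i=1..n. f (c j) * of_bool (\<alpha> i \<in> C j)))"
    by (intro sum.cong refl) (subst mult.left_commute, subst sum_distrib_left, rule refl)
  also have "\<dots> = (1 / real n) * (\<Sum>j=1..k. \<Sum>i=1..n. f (c j) * of_bool (\<alpha> i \<in> C j))"
    by (rule sum_distrib_left[symmetric])
  also have "\<dots> = (1 / real n) * (\<Sum>i=1..n. \<Sum>j=1..k. f (c j) * of_bool (\<alpha> i \<in> C j))"
    by (rule arg_cong[OF sum.swap])
  also have "\<dots> = (1 / real n) * (\<Sum>i=1..n. f (quantizer k C c (\<alpha> i)))"
    by (simp only: * )
  finally show ?thesis
    by (simp add: expectation_empirical_pmf[OF assms(1)])
qed

end

theory Submission
  imports Defs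
begin

text \<open>
  Both approximations are fixed points of averaged best responses
  \<open>z \<mapsto> (1 / n) * (\<Sum>i. Br z (\<beta> i))\<close>: take \<open>\<beta> = \<alpha>\<close> for the empirical one, and let \<open>\<beta> i\<close> be the
  representative of the cell of \<open>\<alpha> i\<close> for the quantized one. Averaging preserves the Lipschitz
  constant in \<open>z\<close>, so each such map is a contraction and has exactly one fixed point; hence both
  definite descriptions denote.

  The two maps differ pointwise by at most \<open>D = L * E\<bar>quantized - original\<bar>\<close>, by the Lipschitz
  condition in the parameter. If \<open>x\<close> and \<open>y\<close> are the fixed points, moving from one to the other
  costs \<open>D\<close> for changing the map and \<open>Lz * \<bar>x - y\<bar>\<close> for changing its argument, so
  \<open>\<bar>x - y\<bar> \<le> Lz * \<bar>x - y\<bar> + D\<close>, and dividing by \<open>1 - Lz\<close> gives the bound.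
\<close>

lemma contraction_fixed_point_perturbation:
  fixes f g :: "real \<Rightarrow> real"
  assumes "c < 1"
    and contr: "\<And>x y. \<bar>f x - f y\<bar> \<le> c * \<bar>x - y\<bar>"
    and "x = f x" and "y = g y"
    and close: "\<bar>f y - g y\<bar> \<le> D"
  shows "\<bar>x - y\<bar> \<le> D / (1 - c)"
proof -
  have "\<bar>x - y\<bar> = \<bar>(f x - f y) + (f y - g y)\<bar>"
    using assms(3,4) by simp
  also have "\<dots> \<le> c * \<bar>x - y\<bar> + D"
    using contr[of x y] close by linarith
  finally show ?thesis
    using \<open>c < 1\<close> by (simp add: field_simps)
qed

lemma abs_diff_mean_le:
  fixes f g h :: "nat \<Rightarrow> real"
  assumes "\<And>i. i \<in> {1..n} \<Longrightarrow> \<bar>f i - g i\<bar> \<le> h i"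
  shows "\<bar>(1 / real n) * (\<Sum>i=1..n. f i) - (1 / real n) * (\<Sum>i=1..n. g i)\<bar>
    \<le> (1 / real n) * (\<Sum>i=1..n. h i)"
proof -
  have "\<bar>(1 / real n) * (\<Sum>i=1..n. f i) - (1 / real n) * (\<Sum>i=1..n. g i)\<bar>
      = (1 / real n) * \<bar>\<Sum>i=1..n. f i - g i\<bar>"
    by (simp add: sum_subtractf flip: diff_divide_distrib)
  also have "\<bar>\<Sum>i=1..n. f i - g i\<bar> \<le> (\<Sum>i=1..n. h i)"
    using assms by (intro order_trans[OF sum_abs] sum_mono) auto
  finally show ?thesis
    by (simp add: mult_left_mono divide_right_mono)
qed

lemma mean_response_contraction:
  fixes Br :: "real \<Rightarrow> real \<Rightarrow> real"
  assumes "n \<ge> 1"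
    and "\<And>z z' \<beta>. \<bar>Br z \<beta> - Br z' \<beta>\<bar> \<le> Lz * \<bar>z - z'\<bar>"
  shows "\<bar>(1 / real n) * (\<Sum>i=1..n. Br z (\<beta> i)) - (1 / real n) * (\<Sum>i=1..n. Br z' (\<beta> i))\<bar>
    \<le> Lz * \<bar>z - z'\<bar>"
  using abs_diff_mean_le[of n "\<lambda>i. Br z (\<beta> i)" "\<lambda>i. Br z' (\<beta> i)" "\<lambda>_. Lz * \<bar>z - z'\<bar>"] assms
  by simp

lemma P_approx_solution_fixed_point:
  fixes Br :: "real \<Rightarrow> real \<Rightarrow> real"
  assumes "n \<ge> 1" and "0 \<le> Lz" and "Lz < 1"
    and contr: "\<And>z z' \<beta>. \<bar>Br z \<beta> - Br z' \<beta>\<bar> \<le> Lz * \<bar>z - z'\<bar>"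
  shows "P_approx_solution Br n \<beta> = (1 / real n) * (\<Sum>i=1..n. Br (P_approx_solution Br n \<beta>) (\<beta> i))"
proof -
  let ?F = "\<lambda>z. (1 / real n) * (\<Sum>i=1..n. Br z (\<beta> i))"
  have "\<exists>!z. ?F z = z"
    using assms(2,3) mean_response_contraction[OF assms(1) contr]
    by (intro banach_fix_type[of Lz]) (auto simp only: dist_real_def)
  then have "\<exists>!z. z = ?F z"
    by (simp only: eq_commute)
  from theI'[OF this] show ?thesis
    unfolding P_approx_solution_def .
qed

text \<open>
  Grouping the agents by cell and then averaging over the cells is the same as averaging over the
  agents with each parameter replaced by its representative. Thus quantization amounts to a mere
  change of parameters, and existence and uniqueness need to be shown only once.
\<close>

lemma quantized_solution_eq_P_approx_solution:
  assumes "n \<ge> 1" and "quantization k C c"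
  shows "quantized_solution Br n \<alpha> k C c = P_approx_solution Br n (\<lambda>i. quantizer k C c (\<alpha> i))"
proof -
  have "(\<Sum>j=1..k. Br z (c j) * ((1 / real n) * (\<Sum>i=1..n. of_bool (\<alpha> i \<in> C j))))
      = (1 / real n) * (\<Sum>i=1..n. Br z (quantizer k C c (\<alpha> i)))" for z
    using expectation_quantized[OF assms, of \<alpha> "Br z"]
      expectation_empirical_pmf[OF assms(1), of \<alpha> "\<lambda>x. Br z (quantizer k C c x)"]
    by simp
  then show ?thesis
    unfolding quantized_solution_def P_approx_solution_def by simp
qed

lemma P_approx_solution_lipschitz_in_parameters:
  fixes Br :: "real \<Rightarrow> real \<Rightarrow> real"
  assumes "n \<ge> 1" and "0 \<le> Lz" and "Lz < 1"
    and contr: "\<And>z z' \<beta>. \<bar>Br z \<beta> - Br z' \<beta>\<bar> \<le> Lz * \<bar>z - z'\<bar>"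
    and lip: "\<And>z \<beta> \<beta>'. \<bar>Br z \<beta> - Br z \<beta>'\<bar> \<le> L * \<bar>\<beta> - \<beta>'\<bar>"
  shows "\<bar>P_approx_solution Br n \<beta> - P_approx_solution Br n \<alpha>\<bar>
    \<le> L / (1 - Lz) * ((1 / real n) * (\<Sum>i=1..n. \<bar>\<beta> i - \<alpha> i\<bar>))"
proof -
  let ?F = "\<lambda>\<beta> z. (1 / real n) * (\<Sum>i=1..n. Br z (\<beta> i))"
  have "\<bar>?F \<beta> z - ?F \<alpha> z\<bar> \<le> (1 / real n) * (\<Sum>i=1..n. L * \<bar>\<beta> i - \<alpha> i\<bar>)" for z
    by (intro abs_diff_mean_le lip)
  then have "\<bar>?F \<beta> z - ?F \<alpha> z\<bar> \<le> L * ((1 / real n) * (\<Sum>i=1..n. \<bar>\<beta> i - \<alpha> i\<bar>))" for z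
    by (simp add: sum_distrib_left[symmetric])
  then have "\<bar>P_approx_solution Br n \<beta> - P_approx_solution Br n \<alpha>\<bar>
      \<le> L * ((1 / real n) * (\<Sum>i=1..n. \<bar>\<beta> i - \<alpha> i\<bar>)) / (1 - Lz)"
    by (rule contraction_fixed_point_perturbation
        [where f = "?F \<beta>" and g = "?F \<alpha>", OF assms(3)
          mean_response_contraction[OF assms(1) contr]
          P_approx_solution_fixed_point[OF assms(1-4)]
          P_approx_solution_fixed_point[OF assms(1-4)]])
  then show ?thesis
    by (simp add: mult.commute)
qed

theorem proposition4:
  fixes n k :: nat
    and a b Lz L :: real
    and u :: "real \<Rightarrow> real \<Rightarrow> real \<Rightarrow> real"
    and \<alpha> c :: "nat \<Rightarrow> real"
    and C :: "nat \<Rightarrow> real set"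
  defines "Br \<equiv> best_response u a b"
  assumes "n \<ge> 2" and "a \<le> b"
    and "unique_best_response u a b"
    and "0 < Lz" and "Lz < 1"
    and "\<And>z z' \<beta>. \<bar>Br z \<beta> - Br z' \<beta>\<bar> \<le> Lz * \<bar>z - z'\<bar>"
    and "0 < L"
    and "\<And>z \<beta> \<beta>'. \<bar>Br z \<beta> - Br z \<beta>'\<bar> \<le> L * \<bar>\<beta> - \<beta>'\<bar>"
    and "quantization k C c"
  shows "\<bar>quantized_solution Br n \<alpha> k C c - P_approx_solution Br n \<alpha>\<bar>
    \<le> L / (1 - Lz) * measure_pmf.expectation (empirical_pmf n \<alpha>) (\<lambda>\<nu>. \<bar>quantizer k C c \<nu> - \<nu>\<bar>)"
proof -
  have n: "n \<ge> 1"
    using \<open>n \<ge> 2\<close> by simp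
  show ?thesis
    unfolding quantized_solution_eq_P_approx_solution[OF n \<open>quantization k C c\<close>]
      expectation_empirical_pmf[OF n]
    by (rule P_approx_solution_lipschitz_in_parameters) (use n assms in auto)
qed

end
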